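(* Let $(S,+)$ be an abelian semigroup with identity $0$, let $(u_{s,t})_{t\ge s}$ be a Borel Markov transition function on $S$ such that $u_{s,t}(0,\cdot)=\delta_0$ and $u_{s,t}(x+y,\cdot)=u_{s,t}(x,\cdot)*u_{s,t}(y,\cdot)$ for all $t\ge s$ and $x,y\in S$, and let $(\mu_{t,s})_{t\ge s}$ be a family of probability measures on $(S,\mathcal{B}(S))$. Define $q_{s,t}(x,\cdot)=u_{s,t}(x,\cdot)*\mu_{t,s}$ and $q_{s,t}f(x)=\int_S f(y)\,q_{s,t}(x,dy)$ for $x\in S$ and bounded measurable $f:S\to\mathbb{R}$. Then the family of operators $(q_{s,t})_{t\ge s}$ satisfies $$q_{s,t}=q_{s,r}\,q_{r,t},\qquad t\ge r\ge s,$$ if and only if $$\mu_{t,s}=\mu_{t,r}*(\mu_{r,s}u_{r,t}),\qquad t\ge r\ge s,$$ or equivalently $$\hat\mu_{t,s}(\xi)=\hat\mu_{t,r}(\xi)\,\widehat{(\mu_{r,s}u_{r,t})}(\xi),\qquad \xi\in S,\ t\ge r\ge s.$$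
   Context: $S$ carries a Borel $\sigma$-algebra $\mathcal{B}(S)$ for which addition $S\times S\to S$ is measurable. A Markov transition function $(u_{s,t})_{t\ge s}$, $s,t\in\mathbb{R}$, is a family of probability kernels on $S$ satisfying the Chapman–Kolmogorov equations $u_{s,t}(x,A)=\int_S u_{r,t}(y,A)\,u_{s,r}(x,dy)$ for $t\ge r\ge s$. The convolution $\mu*\nu$ of measures on $S$ is the image of $\mu\otimes\nu$ under addition. For a probability measure $\mu$ on $S$, $\mu u_{s,t}(A)=\int_S u_{s,t}(x,A)\,\mu(dx)$, $A\in\mathcal{B}(S)$. The hat denotes the characteristic functional (Fourier transform) of a probability measure, $\hat\mu(\xi)=\int_S e^{i\langle x,\xi\rangle}\,\mu(dx)$; the paper gives this definition when $S$ is a real separable Hilbert space with inner product $\langle\cdot,\cdot\rangle$, and uses the same notation in the last displayed condition. *)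

theory Defs
  imports "HOL-Probability.Probability"
begin

text \<open>
  The library's \<^const>\<open>convolution\<close> is restricted to ordered Euclidean spaces. Measures are
  added along the product \<open>\<sigma>\<close>-algebra \<open>\<B>(S) \<otimes> \<B>(S)\<close>, which may be smaller than the Borel
  \<open>\<sigma>\<close>-algebra of the product topology.
\<close>

definition conv_measure ::
  "'a::{topological_space, comm_monoid_add} measure \<Rightarrow> 'a measure \<Rightarrow> 'a measure"
  (infixl \<open>\<^bold>*\<close> 70) where
  "M \<^bold>* N = distr (M \<Otimes>\<^sub>M N) borel (\<lambda>(x, y). x + y)"

text \<open>Only the values \<open>u s t\<close> with \<open>s \<le> t\<close> are meaningful.\<close>

definition markov_transition ::
  "(real \<Rightarrow> real \<Rightarrow> 'a::topological_space \<Rightarrow> 'a measure) \<Rightarrow> bool" where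
  "markov_transition u \<longleftrightarrow>
     (\<forall>s t. s \<le> t \<longrightarrow> u s t \<in> borel \<rightarrow>\<^sub>M prob_algebra borel) \<and>
     (\<forall>s r t x. \<forall>A\<in>sets borel. s \<le> r \<longrightarrow> r \<le> t \<longrightarrow>
        emeasure (u s t x) A = (\<integral>\<^sup>+ y. emeasure (u r t y) A \<partial>(u s r x)))"

definition additive_transition ::
  "(real \<Rightarrow> real \<Rightarrow> 'a::{topological_space, comm_monoid_add} \<Rightarrow> 'a measure) \<Rightarrow> bool" where
  "additive_transition u \<longleftrightarrow>
     (\<forall>s t. s \<le> t \<longrightarrow> u s t 0 = return borel 0) \<and>
     (\<forall>s t x y. s \<le> t \<longrightarrow> u s t (x + y) = u s t x \<^bold>* u s t y)"

text \<open>The order of the time indices follows \<open>\<mu>\<^sub>t\<^sub>,\<^sub>s\<close>: the later time comes first.\<close>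

definition prob_family :: "(real \<Rightarrow> real \<Rightarrow> 'a::topological_space measure) \<Rightarrow> bool" where
  "prob_family \<mu> \<longleftrightarrow> (\<forall>s t. s \<le> t \<longrightarrow> prob_space (\<mu> t s) \<and> sets (\<mu> t s) = sets borel)"

definition mehler_kernel ::
  "(real \<Rightarrow> real \<Rightarrow> 'a::{topological_space, comm_monoid_add} \<Rightarrow> 'a measure) \<Rightarrow>
   (real \<Rightarrow> real \<Rightarrow> 'a measure) \<Rightarrow> real \<Rightarrow> real \<Rightarrow> 'a \<Rightarrow> 'a measure" where
  "mehler_kernel u \<mu> s t x = u s t x \<^bold>* \<mu> t s"

definition kernel_op :: "('a \<Rightarrow> 'a measure) \<Rightarrow> ('a \<Rightarrow> real) \<Rightarrow> 'a \<Rightarrow> real" where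
  "kernel_op K f x = (\<integral>y. f y \<partial>K x)"

text \<open>\<open>q\<^sub>s\<^sub>,\<^sub>t = q\<^sub>s\<^sub>,\<^sub>r q\<^sub>r\<^sub>,\<^sub>t\<close> as operators on the bounded Borel functions.\<close>

definition evolution_family ::
  "(real \<Rightarrow> real \<Rightarrow> 'a::topological_space \<Rightarrow> 'a measure) \<Rightarrow> bool" where
  "evolution_family q \<longleftrightarrow>
     (\<forall>s r t. s \<le> r \<longrightarrow> r \<le> t \<longrightarrow>
        (\<forall>f. f \<in> borel_measurable borel \<longrightarrow> bounded (range f) \<longrightarrow>
           kernel_op (q s t) f = kernel_op (q s r) (kernel_op (q r t) f)))"

text \<open>The measure \<open>\<mu>u(A) = \<integral> u(x,A) \<mu>(dx)\<close> is the Giry monad's \<open>\<mu> \<bind> u\<close>.\<close>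

definition skew_convolution ::
  "(real \<Rightarrow> real \<Rightarrow> 'a::{topological_space, comm_monoid_add} \<Rightarrow> 'a measure) \<Rightarrow>
   (real \<Rightarrow> real \<Rightarrow> 'a measure) \<Rightarrow> bool" where
  "skew_convolution u \<mu> \<longleftrightarrow>
     (\<forall>s r t. s \<le> r \<longrightarrow> r \<le> t \<longrightarrow> \<mu> t s = \<mu> t r \<^bold>* (\<mu> r s \<bind> u r t))"

definition char_functional :: "'h::real_inner measure \<Rightarrow> 'h \<Rightarrow> complex" where
  "char_functional M \<xi> = (CLINT x|M. iexp (x \<bullet> \<xi>))"

definition skew_convolution_char ::
  "(real \<Rightarrow> real \<Rightarrow> 'h::real_inner \<Rightarrow> 'h measure) \<Rightarrow> (real \<Rightarrow> real \<Rightarrow> 'h measure) \<Rightarrow> bool" where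
  "skew_convolution_char u \<mu> \<longleftrightarrow>
     (\<forall>s r t \<xi>. s \<le> r \<longrightarrow> r \<le> t \<longrightarrow>
        char_functional (\<mu> t s) \<xi> =
          char_functional (\<mu> t r) \<xi> * char_functional (\<mu> r s \<bind> u r t) \<xi>)"

end

theory Submission
  imports Defs
begin

text \<open>
  The operator equation says that the kernels \<open>q\<close> satisfy the Chapman--Kolmogorov equation
  (\<open>evolution_family_iff_bind\<close>). Because \<open>u\<close> turns sums into convolutions, it acts on measures as a
  homomorphism for convolution (\<open>conv_bind\<close>). Composing the kernels \<open>q\<close> from \<open>s\<close> to \<open>r\<close> and from \<open>r\<close>
  to \<open>t\<close> therefore gives \<open>u s t x \<^bold>* (\<mu> t r \<^bold>* (\<mu> r s \<bind> u r t))\<close> at the point \<open>x\<close>, whereas the kernel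
  from \<open>s\<close> to \<open>t\<close> is \<open>u s t x \<^bold>* \<mu> t s\<close>. If the skew convolution equation holds, these coincide for
  all \<open>x\<close>; conversely, at \<open>x = 0\<close> the first factor is \<open>\<delta>\<^sub>0\<close>, the unit of convolution, and the skew
  convolution equation remains.

  For the equation of characteristic functionals, it remains to know that the functional is
  multiplicative (\<open>char_functional_conv\<close>) and determines the measure (\<open>char_functional_unique\<close>).
  Uniqueness on a separable inner product space is derived from the one-dimensional uniqueness theorem
  of Levy. Equality of the functionals of two finite measures is preserved on weighting both with
  \<open>1 + cos (x \<bullet> \<zeta> + \<theta>)\<close>, since products of cosines are sums of cosines. Projecting the weighted
  measures to a line and comparing the masses of a half-line shows that the equality is also preserved
  on restricting both measures to a half-space. By induction the two measures agree on finite
  intersections of half-spaces, and in a separable space these generate the Borel sets.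
\<close>

section \<open>Convolution and kernels on a measurable semigroup\<close>

lemma bind_in_prob_algebra:
  assumes "M \<in> space (prob_algebra L)" "\<kappa> \<in> L \<rightarrow>\<^sub>M prob_algebra N"
  shows "M \<bind> \<kappa> \<in> space (prob_algebra N)"
  using prob_space_bind'[OF assms] sets_bind'[OF assms] by (simp add: space_prob_algebra)

context
  assumes add_measurable [measurable]:
    "(\<lambda>(x, y). x + y) \<in> borel \<Otimes>\<^sub>M borel \<rightarrow>\<^sub>M
       (borel :: 'a::{topological_space, comm_monoid_add} measure)"
begin

lemma sum_measurable [measurable (raw)]:
  fixes f g :: "'b \<Rightarrow> 'a"
  assumes [measurable]: "f \<in> L \<rightarrow>\<^sub>M borel" "g \<in> L \<rightarrow>\<^sub>M borel"
  shows "(\<lambda>z. f z + g z) \<in> L \<rightarrow>\<^sub>M borel"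
proof -
  have "(\<lambda>z. (f z, g z)) \<in> L \<rightarrow>\<^sub>M borel \<Otimes>\<^sub>M borel" by measurable
  from measurable_compose[OF this add_measurable] show ?thesis by simp
qed

lemma conv_in_prob_algebra:
  fixes M N :: "'a measure"
  assumes M: "M \<in> space (prob_algebra borel)" and N: "N \<in> space (prob_algebra borel)"
  shows "M \<^bold>* N \<in> space (prob_algebra borel)"
proof -
  have "M \<Otimes>\<^sub>M N \<in> space (prob_algebra (borel \<Otimes>\<^sub>M borel))"
    using assms by (auto simp: space_prob_algebra intro!: prob_space_pair sets_pair_measure_cong)
  then show ?thesis
    unfolding conv_measure_def
    by (rule measurable_space[OF measurable_distr_prob_space[OF add_measurable]])
qed

text \<open>
  This formula reduces commutativity, associativity and the behaviour of convolution under averaging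
  to identities between iterated integrals.
\<close>

lemma nn_integral_conv:
  fixes M N :: "'a measure"
  assumes M: "M \<in> space (prob_algebra borel)" and N: "N \<in> space (prob_algebra borel)"
    and f [measurable]: "f \<in> borel_measurable borel"
  shows "(\<integral>\<^sup>+z. f z \<partial>(M \<^bold>* N)) = (\<integral>\<^sup>+x. \<integral>\<^sup>+y. f (x + y) \<partial>N \<partial>M)"
proof -
  have sets_M [measurable_cong]: "sets M = sets borel"
    and sets_N [measurable_cong]: "sets N = sets borel"
    using M N by (auto simp: space_prob_algebra)
  interpret N: prob_space N using N by (simp add: space_prob_algebra)
  show ?thesis
    by (simp add: conv_measure_def nn_integral_distr N.nn_integral_fst[symmetric])
qed

lemma emeasure_conv:
  fixes M N :: "'a measure"
  assumes "M \<in> space (prob_algebra borel)" "N \<in> space (prob_algebra borel)"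
    and A [measurable]: "A \<in> sets borel"
  shows "emeasure (M \<^bold>* N) A = (\<integral>\<^sup>+x. \<integral>\<^sup>+y. indicator A (x + y) \<partial>N \<partial>M)"
proof -
  have "emeasure (M \<^bold>* N) A = (\<integral>\<^sup>+z. indicator A z \<partial>(M \<^bold>* N))"
    by (simp add: conv_measure_def)
  then show ?thesis
    using assms by (simp add: nn_integral_conv)
qed

lemma conv_commute:
  fixes M N :: "'a measure"
  assumes M: "M \<in> space (prob_algebra borel)" and N: "N \<in> space (prob_algebra borel)"
  shows "M \<^bold>* N = N \<^bold>* M"
proof (rule measure_eqI)
  fix A :: "'a set" assume "A \<in> sets (M \<^bold>* N)"
  then have A [measurable]: "A \<in> sets borel" by (simp add: conv_measure_def)
  have sets [measurable_cong]: "sets M = sets borel" "sets N = sets borel"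
    using M N by (auto simp: space_prob_algebra)
  interpret M: prob_space M using M by (simp add: space_prob_algebra)
  interpret N: prob_space N using N by (simp add: space_prob_algebra)
  interpret pair_sigma_finite M N ..
  show "emeasure (M \<^bold>* N) A = emeasure (N \<^bold>* M) A"
    using Fubini'[of "\<lambda>y x. indicator A (x + y)"]
    by (simp add: emeasure_conv M N add.commute)
qed (simp add: conv_measure_def)

lemma conv_assoc:
  fixes L M N :: "'a measure"
  assumes L: "L \<in> space (prob_algebra borel)" and M: "M \<in> space (prob_algebra borel)"
    and N: "N \<in> space (prob_algebra borel)"
  shows "(L \<^bold>* M) \<^bold>* N = L \<^bold>* (M \<^bold>* N)"
proof (rule measure_eqI)
  fix A :: "'a set" assume "A \<in> sets ((L \<^bold>* M) \<^bold>* N)"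
  then have A [measurable]: "A \<in> sets borel" by (simp add: conv_measure_def)
  have sets [measurable_cong]: "sets L = sets borel" "sets M = sets borel" "sets N = sets borel"
    using L M N by (auto simp: space_prob_algebra)
  interpret N: prob_space N using N by (simp add: space_prob_algebra)
  show "emeasure ((L \<^bold>* M) \<^bold>* N) A = emeasure (L \<^bold>* (M \<^bold>* N)) A"
    by (simp add: emeasure_conv nn_integral_conv L M N conv_in_prob_algebra add.assoc)
qed (simp add: conv_measure_def)

lemma return_0_conv:
  fixes M :: "'a measure"
  assumes M: "M \<in> space (prob_algebra borel)"
  shows "return borel 0 \<^bold>* M = M"
proof (rule measure_eqI)
  fix A :: "'a set" assume "A \<in> sets (return borel 0 \<^bold>* M)"
  then have A [measurable]: "A \<in> sets borel" by (simp add: conv_measure_def)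
  have sets [measurable_cong]: "sets M = sets borel"
    using M by (auto simp: space_prob_algebra)
  interpret M: prob_space M using M by (simp add: space_prob_algebra)
  have "return borel (0::'a) \<in> space (prob_algebra borel)"
    by (simp add: space_prob_algebra prob_space_return)
  then show "emeasure (return borel 0 \<^bold>* M) A = emeasure M A"
    by (simp add: emeasure_conv M nn_integral_return)
qed (use M in \<open>simp add: conv_measure_def space_prob_algebra\<close>)

lemma measurable_conv [measurable]:
  fixes N :: "'a measure"
  assumes [measurable]: "\<kappa> \<in> borel \<rightarrow>\<^sub>M prob_algebra borel" and N: "N \<in> space (prob_algebra borel)"
  shows "(\<lambda>x. \<kappa> x \<^bold>* N) \<in> borel \<rightarrow>\<^sub>M prob_algebra borel"
proof -
  have [measurable]: "(\<lambda>x. N) \<in> borel \<rightarrow>\<^sub>M prob_algebra borel" using N by simp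
  show ?thesis unfolding conv_measure_def by measurable
qed

text \<open>
  Bilinearity of convolution, extended from finite mixtures to integrals: convolving with a fixed
  \<open>N\<close> commutes with averaging the other factor over \<open>M\<close>.
\<close>

lemma bind_conv_right:
  fixes M N :: "'a measure" and \<kappa> :: "'a \<Rightarrow> 'a measure"
  assumes M: "M \<in> space (prob_algebra borel)" and N: "N \<in> space (prob_algebra borel)"
    and \<kappa> [measurable]: "\<kappa> \<in> borel \<rightarrow>\<^sub>M prob_algebra borel"
  shows "M \<bind> (\<lambda>x. \<kappa> x \<^bold>* N) = (M \<bind> \<kappa>) \<^bold>* N"
proof (rule measure_eqI)
  note [simp] = measurable_space[OF \<kappa>, simplified]
  have sets [measurable_cong, simp]: "sets M = sets borel" "sets N = sets borel"
    using M N by (auto simp: space_prob_algebra)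
  interpret N: prob_space N using N by (simp add: space_prob_algebra)
  have M_kernel: "\<kappa> \<in> M \<rightarrow>\<^sub>M subprob_algebra borel"
    by (intro measurable_prob_algebraD) measurable
  have conv_kernel: "(\<lambda>x. \<kappa> x \<^bold>* N) \<in> borel \<rightarrow>\<^sub>M prob_algebra borel"
    using N by measurable
  show sets_eq: "sets (M \<bind> (\<lambda>x. \<kappa> x \<^bold>* N)) = sets ((M \<bind> \<kappa>) \<^bold>* N)"
    using bind_in_prob_algebra[OF M conv_kernel] by (simp add: space_prob_algebra conv_measure_def)
  fix A assume "A \<in> sets (M \<bind> (\<lambda>x. \<kappa> x \<^bold>* N))"
  then have A [measurable]: "A \<in> sets borel" unfolding sets_eq by (simp add: conv_measure_def)
  have "emeasure ((M \<bind> \<kappa>) \<^bold>* N) A = (\<integral>\<^sup>+z. \<integral>\<^sup>+y. indicator A (z + y) \<partial>N \<partial>(M \<bind> \<kappa>))"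
    by (simp add: emeasure_conv bind_in_prob_algebra[OF M \<kappa>] N)
  also have "\<dots> = (\<integral>\<^sup>+x. \<integral>\<^sup>+z. \<integral>\<^sup>+y. indicator A (z + y) \<partial>N \<partial>\<kappa> x \<partial>M)"
    by (rule nn_integral_bind[OF _ M_kernel]) measurable
  also have "\<dots> = (\<integral>\<^sup>+x. emeasure (\<kappa> x \<^bold>* N) A \<partial>M)"
    by (simp add: emeasure_conv N)
  also have "\<dots> = emeasure (M \<bind> (\<lambda>x. \<kappa> x \<^bold>* N)) A"
    by (rule emeasure_bind_prob_algebra[symmetric, OF M conv_kernel A])
  finally show "emeasure (M \<bind> (\<lambda>x. \<kappa> x \<^bold>* N)) A = emeasure ((M \<bind> \<kappa>) \<^bold>* N) A" ..
qed

lemma bind_conv_left: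
  fixes M N :: "'a measure" and \<kappa> :: "'a \<Rightarrow> 'a measure"
  assumes M: "M \<in> space (prob_algebra borel)" and N: "N \<in> space (prob_algebra borel)"
    and \<kappa>: "\<kappa> \<in> borel \<rightarrow>\<^sub>M prob_algebra borel"
  shows "M \<bind> (\<lambda>x. N \<^bold>* \<kappa> x) = N \<^bold>* (M \<bind> \<kappa>)"
  using bind_conv_right[OF M N \<kappa>] measurable_space[OF \<kappa>]
  by (simp add: conv_commute[OF N] bind_in_prob_algebra[OF M \<kappa>])

text \<open>
  The left side averages \<open>\<kappa> (x + y) = \<kappa> x \<^bold>* \<kappa> y\<close> over independent \<open>x\<close> and \<open>y\<close>, and both averages
  can be pulled inside the convolution. So additivity of a kernel on points passes to measures.
\<close>

lemma conv_bind:
  fixes M N :: "'a measure" and \<kappa> :: "'a \<Rightarrow> 'a measure"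
  assumes M: "M \<in> space (prob_algebra borel)" and N: "N \<in> space (prob_algebra borel)"
    and \<kappa> [measurable]: "\<kappa> \<in> borel \<rightarrow>\<^sub>M prob_algebra borel"
    and add: "\<And>x y. \<kappa> (x + y) = \<kappa> x \<^bold>* \<kappa> y"
  shows "(M \<^bold>* N) \<bind> \<kappa> = (M \<bind> \<kappa>) \<^bold>* (N \<bind> \<kappa>)"
proof -
  have [measurable_cong, simp]: "sets M = sets borel" "sets N = sets borel"
    using M N by (auto simp: space_prob_algebra)
  have [simp]: "\<kappa> x \<in> space (prob_algebra borel)" for x
    using measurable_space[OF \<kappa>] by simp
  have N\<kappa>: "N \<bind> \<kappa> \<in> space (prob_algebra borel)"
    by (rule bind_in_prob_algebra[OF N \<kappa>])
  have "(M \<^bold>* N) \<bind> \<kappa> = M \<bind> (\<lambda>x. N \<bind> (\<lambda>y. \<kappa> (x + y)))"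
  proof (rule measure_eqI)
    have MN: "M \<^bold>* N \<in> space (prob_algebra borel)"
      by (rule conv_in_prob_algebra[OF M N])
    have [measurable]: "(\<lambda>x. N) \<in> borel \<rightarrow>\<^sub>M prob_algebra borel" using N by simp
    have shift: "(\<lambda>y. \<kappa> (x + y)) \<in> borel \<rightarrow>\<^sub>M prob_algebra borel" for x
      by measurable
    have inner: "(\<lambda>x. N \<bind> (\<lambda>y. \<kappa> (x + y))) \<in> borel \<rightarrow>\<^sub>M prob_algebra borel"
      by measurable
    show "sets ((M \<^bold>* N) \<bind> \<kappa>) = sets (M \<bind> (\<lambda>x. N \<bind> (\<lambda>y. \<kappa> (x + y))))"
      by (simp add: sets_bind'[OF MN \<kappa>] sets_bind'[OF M inner])
    fix A assume "A \<in> sets ((M \<^bold>* N) \<bind> \<kappa>)"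
    then have [measurable]: "A \<in> sets borel" by (simp add: sets_bind'[OF MN \<kappa>])
    have [measurable]: "(\<lambda>z. emeasure (\<kappa> z) A) \<in> borel_measurable borel"
      by (rule measurable_emeasure_kernel[OF measurable_prob_algebraD[OF \<kappa>]]) simp
    show "emeasure ((M \<^bold>* N) \<bind> \<kappa>) A = emeasure (M \<bind> (\<lambda>x. N \<bind> (\<lambda>y. \<kappa> (x + y)))) A"
      by (simp add: emeasure_bind_prob_algebra[OF MN \<kappa>] emeasure_bind_prob_algebra[OF M inner]
          emeasure_bind_prob_algebra[OF N shift] nn_integral_conv M N)
  qed
  also have "\<dots> = M \<bind> (\<lambda>x. \<kappa> x \<^bold>* (N \<bind> \<kappa>))"
    by (simp add: add bind_conv_left[where \<kappa> = \<kappa>] N \<kappa>)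
  also have "\<dots> = (M \<bind> \<kappa>) \<^bold>* (N \<bind> \<kappa>)"
    by (rule bind_conv_right[OF M N\<kappa> \<kappa>])
  finally show ?thesis .
qed

end

lemma markov_transition_bind:
  fixes u :: "real \<Rightarrow> real \<Rightarrow> 'b::topological_space \<Rightarrow> 'b measure"
  assumes "markov_transition u" "s \<le> r" "r \<le> t"
  shows "u s r x \<bind> u r t = u s t x"
proof (rule measure_eqI)
  have k: "u s r \<in> borel \<rightarrow>\<^sub>M prob_algebra borel" "u r t \<in> borel \<rightarrow>\<^sub>M prob_algebra borel"
     "u s t \<in> borel \<rightarrow>\<^sub>M prob_algebra borel"
    using assms by (auto simp: markov_transition_def)
  have x: "u s r x \<in> space (prob_algebra borel)" "u s t x \<in> space (prob_algebra borel)"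
    using k[THEN measurable_space] by auto
  show sets: "sets (u s r x \<bind> u r t) = sets (u s t x)"
    using sets_bind'[OF x(1) k(2)] x by (simp add: space_prob_algebra)
  fix A assume "A \<in> sets (u s r x \<bind> u r t)"
  then have A: "A \<in> sets borel" using x sets by (simp add: space_prob_algebra)
  then show "emeasure (u s r x \<bind> u r t) A = emeasure (u s t x) A"
    using assms by (simp add: emeasure_bind_prob_algebra[OF x(1) k(2)] markov_transition_def)
qed

lemma space_prob_algebra_UNIV: "M \<in> space (prob_algebra borel) \<Longrightarrow> space M = UNIV"
  using sets_eq_imp_space_eq[of M borel] by (simp add: space_prob_algebra)

text \<open>
  The composition of the operators of two kernels is the operator of the composed kernel, and
  indicator functions already separate measures. Hence the operator equation is the
  Chapman--Kolmogorov equation of the kernels.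
\<close>

lemma evolution_family_iff_bind:
  fixes q :: "real \<Rightarrow> real \<Rightarrow> 'b::topological_space \<Rightarrow> 'b measure"
  assumes q: "\<And>s t. s \<le> t \<Longrightarrow> q s t \<in> borel \<rightarrow>\<^sub>M prob_algebra borel"
  shows "evolution_family q \<longleftrightarrow>
    (\<forall>s r t x. s \<le> r \<longrightarrow> r \<le> t \<longrightarrow> q s t x = q s r x \<bind> q r t)"
proof -
  have compose: "kernel_op (q s r) (kernel_op (q r t) f) x = (\<integral>y. f y \<partial>(q s r x \<bind> q r t))"
    if "s \<le> r" "r \<le> t" "f \<in> borel_measurable borel" "bounded (range f)"
    for s r t :: real and f :: "'b \<Rightarrow> real" and x
  proof -
    obtain B where B: "\<And>y. \<bar>f y\<bar> \<le> B" using \<open>bounded (range f)\<close> unfolding bounded_iff by auto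
    have x: "q s r x \<in> space (prob_algebra borel)"
      using measurable_space[OF q[OF that(1)]] by simp
    show ?thesis
      unfolding kernel_op_def
    proof (rule integral_bind[symmetric, where K = borel and B = B and B' = 1])
      have sets_x: "sets (q s r x) = sets borel" and "prob_space (q s r x)"
        using x by (auto simp: space_prob_algebra)
      then show "finite_measure (q s r x)" by (simp add: prob_space_def)
      show "q r t \<in> q s r x \<rightarrow>\<^sub>M subprob_algebra borel"
        using measurable_prob_algebraD[OF q[OF that(2)]]
        unfolding measurable_cong_sets[OF sets_x refl] .
      have "prob_space (q r t y)" for y
        using measurable_space[OF q[OF that(2)], of y] by (simp add: space_prob_algebra)
      then show "AE y in q s r x. emeasure (q r t y) (space (q r t y)) \<le> ennreal 1"
        by (simp add: prob_space.emeasure_space_1)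
    qed (use B that in auto)
  qed
  show ?thesis
  proof (intro iffI allI impI)
    fix s r t :: real and x assume ev: "evolution_family q" and st: "s \<le> r" "r \<le> t"
    have "q s t \<in> borel \<rightarrow>\<^sub>M prob_algebra borel"
      "(\<lambda>x. q s r x \<bind> q r t) \<in> borel \<rightarrow>\<^sub>M prob_algebra borel"
      using st by (auto intro!: q measurable_bind_prob_space[where N = borel])
    from this[THEN measurable_space, of x]
    have P: "q s t x \<in> space (prob_algebra borel)" "q s r x \<bind> q r t \<in> space (prob_algebra borel)"
      by simp_all
    show "q s t x = q s r x \<bind> q r t"
    proof (rule measure_eqI)
      show "sets (q s t x) = sets (q s r x \<bind> q r t)" using P by (simp add: space_prob_algebra)
      fix A assume "A \<in> sets (q s t x)"
      then have A: "A \<in> sets borel" using P by (simp add: space_prob_algebra)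
      have bnd: "bounded (range (indicator A :: 'b \<Rightarrow> real))"
        by (auto simp: bounded_iff indicator_def intro!: exI[of _ 1])
      have "kernel_op (q s t) (indicator A) x = kernel_op (q s r) (kernel_op (q r t) (indicator A)) x"
        using ev st A bnd by (simp add: evolution_family_def)
      then have "(\<integral>y. indicator A y \<partial>q s t x) = (\<integral>y. indicator A y \<partial>(q s r x \<bind> q r t) :: real)"
        using compose[OF st _ bnd] A by (simp add: kernel_op_def)
      then have "measure (q s t x) A = measure (q s r x \<bind> q r t) A"
        using A P[THEN space_prob_algebra_UNIV] P by (simp add: space_prob_algebra)
      then show "emeasure (q s t x) A = emeasure (q s r x \<bind> q r t) A"
        using P by (simp add: space_prob_algebra prob_space_def finite_measure.emeasure_eq_measure)
    qed
  next
    assume bind: "\<forall>s r t x. s \<le> r \<longrightarrow> r \<le> t \<longrightarrow> q s t x = q s r x \<bind> q r t"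
    show "evolution_family q"
      unfolding evolution_family_def
    proof (intro allI impI ext)
      fix s r t :: real and f :: "'b \<Rightarrow> real" and x
      assume st: "s \<le> r" "r \<le> t" and f: "f \<in> borel_measurable borel" "bounded (range f)"
      have "q s t x = q s r x \<bind> q r t" using bind st by blast
      then show "kernel_op (q s t) f x = kernel_op (q s r) (kernel_op (q r t) f) x"
        unfolding compose[OF st f] by (simp add: kernel_op_def)
    qed
  qed
qed

text \<open>
  The composed kernel computes to \<open>u s t x \<^bold>* (\<mu> t r \<^bold>* (\<mu> r s \<bind> u r t))\<close>, to be compared with
  \<open>u s t x \<^bold>* \<mu> t s\<close>. Measures on a semigroup need not cancel, but at \<open>x = 0\<close> the common factor is the
  unit \<open>\<delta>\<^sub>0\<close>.
\<close>

lemma mehler_kernel_evolution_iff: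
  fixes u :: "real \<Rightarrow> real \<Rightarrow> 'a::{topological_space, comm_monoid_add} \<Rightarrow> 'a measure"
  assumes add: "(\<lambda>(x, y). x + y) \<in> borel \<Otimes>\<^sub>M borel \<rightarrow>\<^sub>M (borel :: 'a measure)"
    and u: "markov_transition u" "additive_transition u" and \<mu>: "prob_family \<mu>"
  shows "evolution_family (mehler_kernel u \<mu>) \<longleftrightarrow> skew_convolution u \<mu>"
proof -
  let ?q = "mehler_kernel u \<mu>"
  have k: "u s t \<in> borel \<rightarrow>\<^sub>M prob_algebra borel" if "s \<le> t" for s t
    using u that by (simp add: markov_transition_def)
  have ux: "u s t x \<in> space (prob_algebra borel)" if "s \<le> t" for s t x
    using measurable_space[OF k[OF that]] by simp
  have \<mu>_prob: "\<mu> t s \<in> space (prob_algebra borel)" if "s \<le> t" for s t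
    using \<mu> that by (auto simp: prob_family_def space_prob_algebra)
  have q: "?q s t \<in> borel \<rightarrow>\<^sub>M prob_algebra borel" if "s \<le> t" for s t
    unfolding mehler_kernel_def by (rule measurable_conv[OF add, OF k[OF that] \<mu>_prob[OF that]])
  have compose: "?q s r x \<bind> ?q r t = u s t x \<^bold>* (\<mu> t r \<^bold>* (\<mu> r s \<bind> u r t))"
    if st: "s \<le> r" "r \<le> t" for s r t x
  proof -
    have s_t: "s \<le> t" using st by simp
    have \<mu>u: "\<mu> r s \<bind> u r t \<in> space (prob_algebra borel)"
      by (rule bind_in_prob_algebra[OF \<mu>_prob[OF st(1)] k[OF st(2)]])
    have "?q s r x \<bind> ?q r t = ((u s r x \<^bold>* \<mu> r s) \<bind> u r t) \<^bold>* \<mu> t r"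
      unfolding mehler_kernel_def
      by (rule bind_conv_right[OF add, OF conv_in_prob_algebra[OF add, OF ux[OF st(1)] \<mu>_prob[OF st(1)]]
            \<mu>_prob[OF st(2)] k[OF st(2)]])
    also have "(u s r x \<^bold>* \<mu> r s) \<bind> u r t = (u s r x \<bind> u r t) \<^bold>* (\<mu> r s \<bind> u r t)"
    proof (rule conv_bind[OF add, OF ux[OF st(1)] \<mu>_prob[OF st(1)] k[OF st(2)]])
      show "u r t (x + y) = u r t x \<^bold>* u r t y" for x y
        using u(2) st by (simp add: additive_transition_def)
    qed
    also have "u s r x \<bind> u r t = u s t x"
      by (rule markov_transition_bind[OF u(1) st])
    also have "u s t x \<^bold>* (\<mu> r s \<bind> u r t) \<^bold>* \<mu> t r = u s t x \<^bold>* ((\<mu> r s \<bind> u r t) \<^bold>* \<mu> t r)"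
      by (rule conv_assoc[OF add, OF ux[OF s_t] \<mu>u \<mu>_prob[OF st(2)]])
    also have "(\<mu> r s \<bind> u r t) \<^bold>* \<mu> t r = \<mu> t r \<^bold>* (\<mu> r s \<bind> u r t)"
      by (rule conv_commute[OF add, OF \<mu>u \<mu>_prob[OF st(2)]])
    finally show ?thesis .
  qed
  have step: "(\<forall>x. ?q s t x = ?q s r x \<bind> ?q r t) \<longleftrightarrow> \<mu> t s = \<mu> t r \<^bold>* (\<mu> r s \<bind> u r t)"
    if st: "s \<le> r" "r \<le> t" for s r t
  proof
    have C: "\<mu> t r \<^bold>* (\<mu> r s \<bind> u r t) \<in> space (prob_algebra borel)"
      by (rule conv_in_prob_algebra[OF add, OF \<mu>_prob[OF st(2)]
            bind_in_prob_algebra[OF \<mu>_prob[OF st(1)] k[OF st(2)]]])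
    have s_t: "s \<le> t" using st by simp
    assume "\<forall>x. ?q s t x = ?q s r x \<bind> ?q r t"
    then have "?q s t 0 = ?q s r 0 \<bind> ?q r t" ..
    moreover have "u s t 0 = return borel 0"
      using u(2) s_t by (simp add: additive_transition_def)
    ultimately have "return borel 0 \<^bold>* \<mu> t s = return borel 0 \<^bold>* (\<mu> t r \<^bold>* (\<mu> r s \<bind> u r t))"
      unfolding compose[OF st] by (simp add: mehler_kernel_def)
    then show "\<mu> t s = \<mu> t r \<^bold>* (\<mu> r s \<bind> u r t)"
      unfolding return_0_conv[OF add, OF \<mu>_prob[OF s_t]] return_0_conv[OF add, OF C] .
  next
    assume "\<mu> t s = \<mu> t r \<^bold>* (\<mu> r s \<bind> u r t)"
    then show "\<forall>x. ?q s t x = ?q s r x \<bind> ?q r t"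
      unfolding compose[OF st] by (simp add: mehler_kernel_def)
  qed
  have "evolution_family ?q \<longleftrightarrow> (\<forall>s r t x. s \<le> r \<longrightarrow> r \<le> t \<longrightarrow> ?q s t x = ?q s r x \<bind> ?q r t)"
    by (rule evolution_family_iff_bind[OF q])
  also have "\<dots> \<longleftrightarrow> (\<forall>s r t. s \<le> r \<longrightarrow> r \<le> t \<longrightarrow> (\<forall>x. ?q s t x = ?q s r x \<bind> ?q r t))"
    by blast
  also have "\<dots> \<longleftrightarrow> skew_convolution u \<mu>"
    unfolding skew_convolution_def by (intro all_cong1 imp_cong refl step)
  finally show ?thesis .
qed

section \<open>Measures are determined by their characteristic functional\<close>

text \<open>
  The uniqueness theorem for probability measures carries over by normalisation, as the value of
  the characteristic function at \<open>0\<close> is the total mass.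
\<close>

lemma finite_measure_Levy_uniqueness:
  fixes M N :: "real measure"
  assumes "finite_measure M" "finite_measure N" "sets M = sets borel" "sets N = sets borel"
    and char: "char M = char N"
  shows "M = N"
proof -
  interpret M: finite_measure M by fact
  interpret N: finite_measure N by fact
  have [measurable_cong, simp]: "sets M = sets borel" "sets N = sets borel" by fact+
  have [simp]: "space M = UNIV" "space N = UNIV"
    using sets_eq_imp_space_eq[of M borel] sets_eq_imp_space_eq[of N borel] by auto
  define m where "m = measure M UNIV"
  have "char M 0 = char N 0" using char by simp
  then have N_UNIV: "measure N UNIV = m"
    by (simp add: char_def m_def)
  show ?thesis
  proof (cases "m = 0")
    case True
    have "emeasure M A = 0" "emeasure N A = 0" for A
      using True N_UNIV emeasure_mono[of A UNIV M] emeasure_mono[of A UNIV N]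
      by (auto simp: m_def M.emeasure_eq_measure N.emeasure_eq_measure measure_le_0_iff
          simp flip: ennreal_0 split: if_splits intro: antisym)
    then show ?thesis by (intro measure_eqI) auto
  next
    case False
    then have m: "m > 0" by (simp add: m_def less_le)
    have normalised: "real_distribution (density L (\<lambda>_. ennreal (1 / m)))"
      if "sets L = sets borel" "emeasure L UNIV = ennreal m" for L :: "real measure"
    proof -
      have "space L = UNIV" using sets_eq_imp_space_eq[OF that(1)] by simp
      then have "emeasure (density L (\<lambda>_. ennreal (1 / m))) (space L) = 1"
        using that m by (simp add: emeasure_density_const ennreal_mult[symmetric])
      then show ?thesis using that
        by (intro real_distribution.intro prob_spaceI real_distribution_axioms.intro) auto
    qed
    have "density M (\<lambda>_. ennreal (1 / m)) = density N (\<lambda>_. ennreal (1 / m))"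
    proof (rule Levy_uniqueness)
      show "char (density M (\<lambda>_. ennreal (1 / m))) = char (density N (\<lambda>_. ennreal (1 / m)))"
      proof
        fix t
        have "char (density L (\<lambda>_. ennreal (1 / m))) t = (1 / m) * char L t"
          if [measurable_cong]: "sets L = sets borel" for L :: "real measure"
          using m by (simp add: char_def integral_density scaleR_conv_of_real)
        then show "char (density M (\<lambda>_. ennreal (1 / m))) t = char (density N (\<lambda>_. ennreal (1 / m))) t"
          using char by simp
      qed
    qed (auto intro!: normalised simp: M.emeasure_eq_measure N.emeasure_eq_measure N_UNIV simp flip: m_def)
    then have eq: "ennreal (1 / m) * emeasure M A = ennreal (1 / m) * emeasure N A"
      if "A \<in> sets borel" for A
      using that by (metis emeasure_density_const \<open>sets M = sets borel\<close> \<open>sets N = sets borel\<close>)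
    show ?thesis
    proof (rule measure_eqI)
      fix A assume "A \<in> sets M"
      then show "emeasure M A = emeasure N A"
        using eq[of A] m by (simp add: ennreal_mult_cancel_left)
    qed simp
  qed
qed

text \<open>
  A real form of the equality of characteristic functionals. The phase \<open>\<theta>\<close> covers sines as well as
  cosines, and products of such functions are again sums of such functions.
\<close>

definition cos_integrals_agree :: "'h::real_inner measure \<Rightarrow> 'h measure \<Rightarrow> bool" where
  "cos_integrals_agree M N \<longleftrightarrow>
     (\<forall>\<zeta> \<theta>. (\<integral>x. cos (x \<bullet> \<zeta> + \<theta>) \<partial>M) = (\<integral>x. cos (x \<bullet> \<zeta> + \<theta>) \<partial>N))"

lemma integrable_bounded_borel:
  fixes f :: "'a::topological_space \<Rightarrow> 'b::{banach, second_countable_topology}"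
  assumes "finite_measure M" and [measurable_cong]: "sets M = sets borel"
    and [measurable]: "f \<in> borel_measurable borel" and "\<And>x. norm (f x) \<le> B"
  shows "integrable M f"
  using assms by (intro finite_measure.integrable_const_bound[where B = B]) auto

lemma cos_integrals_agree_iff_char_functional:
  fixes M N :: "'h::{real_inner, second_countable_topology} measure"
  assumes "finite_measure M" "finite_measure N"
    and [measurable_cong]: "sets M = sets borel" "sets N = sets borel"
  shows "cos_integrals_agree M N \<longleftrightarrow> char_functional M = char_functional N"
proof -
  \<comment> \<open>The imaginary part is a phase shift: \<open>sin a = cos (a - pi / 2)\<close>.\<close>
  have re_im: "char_functional L \<xi> = Complex (\<integral>x. cos (x \<bullet> \<xi>) \<partial>L) (\<integral>x. cos (x \<bullet> \<xi> + - pi / 2) \<partial>L)"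
    if "finite_measure L" and L[measurable_cong]: "sets L = sets borel" for L :: "'h measure" and \<xi>
  proof -
    have int: "integrable L (\<lambda>x. iexp (x \<bullet> \<xi>))"
      by (rule integrable_bounded_borel[OF that, where B = 1]) simp_all
    show ?thesis
      unfolding char_functional_def
      using int
      by (auto intro!: complex_eqI simp: integral_Re[symmetric] integral_Im[symmetric]
         cos_diff Re_exp Im_exp simp del: integral_Re integral_Im)
  qed
  have phase: "(\<integral>x. cos (x \<bullet> \<xi> + \<theta>) \<partial>L) = Re (cis \<theta> * char_functional L \<xi>)"
    if "finite_measure L" and L[measurable_cong]: "sets L = sets borel" for L :: "'h measure" and \<xi> \<theta>
  proof -
    have int: "integrable L (\<lambda>x. iexp (x \<bullet> \<xi>))"
      by (rule integrable_bounded_borel[OF that, where B = 1]) simp_all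
    have "Re (cis \<theta> * char_functional L \<xi>) = Re (CLINT x|L. cis \<theta> * iexp (x \<bullet> \<xi>))"
      by (simp add: char_functional_def)
    also have "\<dots> = (\<integral>x. Re (cis \<theta> * iexp (x \<bullet> \<xi>)) \<partial>L)"
      using int by (intro integral_Re[symmetric]) simp
    finally show ?thesis
      by (simp add: Re_exp Im_exp cos_add mult.commute)
  qed
  show ?thesis
  proof
    assume "cos_integrals_agree M N"
    then have eq: "(\<integral>x. cos (x \<bullet> \<zeta> + \<theta>) \<partial>M) = (\<integral>x. cos (x \<bullet> \<zeta> + \<theta>) \<partial>N)" for \<zeta> \<theta>
      by (simp add: cos_integrals_agree_def)
    show "char_functional M = char_functional N"
      using eq[of _ 0] eq[of _ "-pi/2"] by (intro ext) (simp add: re_im assms)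
  qed (simp add: cos_integrals_agree_def phase assms)
qed

text \<open>
  The product-to-sum formula shows that the integrals of cosines against the weighted measures are
  combinations of those against the original ones. The constant \<open>1\<close> keeps the weight nonnegative,
  so that the weighted measures are again positive.
\<close>

lemma cos_integrals_agree_density:
  fixes M N :: "'h::{real_inner, second_countable_topology} measure"
  assumes fin: "finite_measure M" "finite_measure N"
    and sets [measurable_cong]: "sets M = sets borel" "sets N = sets borel"
    and eq: "cos_integrals_agree M N"
  shows "cos_integrals_agree (density M (\<lambda>x. ennreal (1 + cos (x \<bullet> \<eta> + \<phi>))))
           (density N (\<lambda>x. ennreal (1 + cos (x \<bullet> \<eta> + \<phi>))))"
proof -
  have "(\<integral>x. cos (x \<bullet> \<zeta> + \<theta>) \<partial>density L (\<lambda>x. ennreal (1 + cos (x \<bullet> \<eta> + \<phi>)))) =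
      (\<integral>x. cos (x \<bullet> \<zeta> + \<theta>) \<partial>L)
      + ((\<integral>x. cos (x \<bullet> (\<zeta> - \<eta>) + (\<theta> - \<phi>)) \<partial>L) + (\<integral>x. cos (x \<bullet> (\<zeta> + \<eta>) + (\<theta> + \<phi>)) \<partial>L)) / 2"
    if "finite_measure L" and L[measurable_cong]: "sets L = sets borel" for L :: "'h measure" and \<zeta> \<theta>
  proof -
    have int: "integrable L (\<lambda>x. cos (x \<bullet> \<alpha> + \<beta>))" for \<alpha> \<beta>
      by (rule integrable_bounded_borel[OF that, where B = 1]) simp_all
    have nonneg: "0 \<le> 1 + cos a" for a :: real
      using cos_ge_minus_one[of a] by linarith
    have product_to_sum: "cos a * cos b = (cos (b - a) + cos (b + a)) / 2" for a b :: real
      by (simp add: cos_add cos_diff)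
    have "(\<integral>x. cos (x \<bullet> \<zeta> + \<theta>) \<partial>density L (\<lambda>x. ennreal (1 + cos (x \<bullet> \<eta> + \<phi>)))) =
        (\<integral>x. (1 + cos (x \<bullet> \<eta> + \<phi>)) * cos (x \<bullet> \<zeta> + \<theta>) \<partial>L)"
      by (subst integral_density) (simp_all add: nonneg)
    also have "\<dots> = (\<integral>x. cos (x \<bullet> \<zeta> + \<theta>) +
        (cos (x \<bullet> (\<zeta> - \<eta>) + (\<theta> - \<phi>)) + cos (x \<bullet> (\<zeta> + \<eta>) + (\<theta> + \<phi>))) / 2 \<partial>L)"
      by (intro Bochner_Integration.integral_cong refl)
         (simp add: product_to_sum distrib_right inner_simps algebra_simps)
    finally show ?thesis by (simp add: int)
  qed
  then show ?thesis using eq fin sets by (simp add: cos_integrals_agree_def)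
qed

text \<open>
  The characteristic function of a one-dimensional projection is the restriction of the
  characteristic functional to a line.
\<close>

lemma cos_integrals_agree_distr_inner:
  fixes M N :: "'h::{real_inner, second_countable_topology} measure"
  assumes fin: "finite_measure M" "finite_measure N"
    and sets [measurable_cong]: "sets M = sets borel" "sets N = sets borel"
    and eq: "cos_integrals_agree M N"
  shows "distr M borel (\<lambda>x. x \<bullet> \<xi>) = distr N borel (\<lambda>x. x \<bullet> \<xi>)"
proof (rule finite_measure_Levy_uniqueness)
  have "char (distr L borel (\<lambda>x. x \<bullet> \<xi>)) t = char_functional L (t *\<^sub>R \<xi>)"
    if [measurable_cong]: "sets L = sets borel" for L :: "'h measure" and t
    by (simp add: char_def char_functional_def integral_distr)
  then show "char (distr M borel (\<lambda>x. x \<bullet> \<xi>)) = char (distr N borel (\<lambda>x. x \<bullet> \<xi>))"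
    using eq by (auto simp: cos_integrals_agree_iff_char_functional fin sets)
qed (auto intro!: finite_measure.finite_measure_distr fin)

text \<open>
  The inductive step towards joint distributions of several projections. After weighting by
  \<open>1 + cos (x \<bullet> \<zeta> + \<theta>)\<close> the one-dimensional projections of the two measures still coincide, so the
  integrals of this weight over the half-space agree. Subtracting the mass of the half-space leaves
  the integrals of the cosines over it.
\<close>

lemma cos_integrals_agree_halfspace:
  fixes M N :: "'h::{real_inner, second_countable_topology} measure"
  assumes fin: "finite_measure M" "finite_measure N"
    and sets [measurable_cong]: "sets M = sets borel" "sets N = sets borel"
    and eq: "cos_integrals_agree M N"
  shows "cos_integrals_agree (density M (indicator {x. x \<bullet> \<xi> \<le> c}))
           (density N (indicator {x. x \<bullet> \<xi> \<le> c}))"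
proof -
  let ?H = "{x. x \<bullet> \<xi> \<le> c}"
  let ?w = "\<lambda>\<zeta> \<theta> x. 1 + cos (x \<bullet> \<zeta> + \<theta>) :: real"
  have nonneg: "0 \<le> 1 + cos a" for a :: real
    using cos_ge_minus_one[of a] by linarith
  have w: "(\<integral>x. ?w \<zeta> \<theta> x * indicator ?H x \<partial>M) = (\<integral>x. ?w \<zeta> \<theta> x * indicator ?H x \<partial>N)" for \<zeta> \<theta>
  proof -
    have dens: "(\<integral>x. ?w \<zeta> \<theta> x * indicator ?H x \<partial>L) =
        (\<integral>s. (indicator {..c} s :: real) \<partial>distr (density L (?w \<zeta> \<theta>)) borel (\<lambda>x. x \<bullet> \<xi>))"
      if [measurable_cong]: "sets L = sets borel" for L :: "'h measure"
    proof -
      have halfline: "indicator {..c} (x \<bullet> \<xi>) = (indicator ?H x :: real)" for x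
        by (simp add: indicator_def)
      have "(\<integral>s. (indicator {..c} s :: real) \<partial>distr (density L (?w \<zeta> \<theta>)) borel (\<lambda>x. x \<bullet> \<xi>)) =
          (\<integral>x. indicator ?H x \<partial>density L (?w \<zeta> \<theta>))"
        by (subst integral_distr) (simp_all add: halfline)
      also have "\<dots> = (\<integral>x. ?w \<zeta> \<theta> x * indicator ?H x \<partial>L)"
        by (subst integral_density) (simp_all add: nonneg)
      finally show ?thesis by simp
    qed
    have "finite_measure (density L (?w \<zeta> \<theta>))"
      if "finite_measure L" and [measurable_cong]: "sets L = sets borel" for L :: "'h measure"
    proof (rule finite_measureI)
      interpret L: finite_measure L by fact
      have "emeasure (density L (?w \<zeta> \<theta>)) (space L) \<le> (\<integral>\<^sup>+x. ennreal 2 \<partial>L)"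
        by (subst emeasure_density)
           (auto intro!: nn_integral_mono ennreal_leI simp: indicator_def simp del: ennreal_numeral nn_integral_const)
      also have "\<dots> < \<infinity>"
        using L.emeasure_finite[of "space L"]
        by (simp add: ennreal_mult_less_top less_top[symmetric] ennreal_mult_eq_top_iff)
      finally show "emeasure (density L (?w \<zeta> \<theta>)) (space (density L (?w \<zeta> \<theta>))) \<noteq> \<infinity>"
        by simp
    qed
    then have "distr (density M (?w \<zeta> \<theta>)) borel (\<lambda>x. x \<bullet> \<xi>) = distr (density N (?w \<zeta> \<theta>)) borel (\<lambda>x. x \<bullet> \<xi>)"
      using fin sets eq by (intro cos_integrals_agree_distr_inner cos_integrals_agree_density) auto
    then show ?thesis by (simp add: dens sets)
  qed
  \<comment> \<open>As \<open>cos (pi / 2) = 0\<close>, the subtracted weight is the constant \<open>1\<close>.\<close>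
  have "(\<integral>x. cos (x \<bullet> \<zeta> + \<theta>) \<partial>density L (indicator ?H)) =
      (\<integral>x. ?w \<zeta> \<theta> x * indicator ?H x \<partial>L) - (\<integral>x. ?w 0 (pi/2) x * indicator ?H x \<partial>L)"
    if "finite_measure L" and [measurable_cong]: "sets L = sets borel" for L :: "'h measure" and \<zeta> \<theta>
  proof -
    have int: "integrable L (\<lambda>x. ?w \<alpha> \<beta> x * indicator ?H x)" for \<alpha> \<beta>
    proof (rule integrable_bounded_borel[OF that, where B = 2])
      show "norm (?w \<alpha> \<beta> x * indicator ?H x) \<le> 2" for x
        using nonneg[of "x \<bullet> \<alpha> + \<beta>"] cos_le_one[of "x \<bullet> \<alpha> + \<beta>"] by (auto simp: indicator_def)
    qed measurable
    have "(\<integral>x. cos (x \<bullet> \<zeta> + \<theta>) \<partial>density L (\<lambda>x. ennreal (indicator ?H x))) = (\<integral>x. indicator ?H x * cos (x \<bullet> \<zeta> + \<theta>) \<partial>L)"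
      by (subst integral_density) simp_all
    also have "\<dots> = (\<integral>x. ?w \<zeta> \<theta> x * indicator ?H x - ?w 0 (pi/2) x * indicator ?H x \<partial>L)"
      by (intro Bochner_Integration.integral_cong) (auto simp: algebra_simps)
    also have "\<dots> = (\<integral>x. ?w \<zeta> \<theta> x * indicator ?H x \<partial>L) - (\<integral>x. ?w 0 (pi/2) x * indicator ?H x \<partial>L)"
      by (rule Bochner_Integration.integral_diff[OF int int])
    finally show ?thesis by (simp add: ennreal_indicator)
  qed
  then show ?thesis
    unfolding cos_integrals_agree_def by (intro allI) (simp only: fin sets w)
qed

text \<open>
  The finite intersections of closed half-spaces, built one half-space at a time because that is how
  the agreement of cosine integrals propagates.
\<close>

inductive_set cylinders :: "'h::real_inner set set" where
  UNIV: "UNIV \<in> cylinders"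
| Int: "A \<in> cylinders \<Longrightarrow> A \<inter> {x. x \<bullet> \<xi> \<le> c} \<in> cylinders"

lemma Int_stable_cylinders: "Int_stable (cylinders :: 'h::real_inner set set)"
proof (rule Int_stableI)
  fix A B :: "'h set"
  assume A: "A \<in> cylinders" and "B \<in> cylinders"
  from this(2) show "A \<inter> B \<in> cylinders"
  proof induction
    case (Int B \<xi> c)
    then show ?case by (metis Int_assoc cylinders.Int)
  qed (simp add: A)
qed

lemma cylinders_borel: "A \<in> cylinders \<Longrightarrow> A \<in> sets borel"
  by (induction rule: cylinders.induct)
     (simp, intro sets.Int borel_closed[OF closed_Collect_le] continuous_intros)

text \<open>
  For \<open>r \<ge> 0\<close>, by the Cauchy--Schwarz inequality and its case of equality, \<open>norm z \<le> r\<close> holds if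
  and only if \<open>z \<bullet> d \<le> r * norm d\<close> for all \<open>d\<close>. By continuity it suffices to test the \<open>d\<close> in a countable dense
  set, so a closed ball is a countable intersection of half-spaces.
\<close>

lemma cball_in_sigma_cylinders:
  fixes c :: "'h::{real_inner, second_countable_topology}"
  assumes "0 \<le> r"
  shows "cball c r \<in> sigma_sets UNIV cylinders"
proof -
  obtain D :: "'h set" where D: "countable D" "\<And>X. open X \<Longrightarrow> X \<noteq> {} \<Longrightarrow> \<exists>d\<in>D. d \<in> X"
    using countable_dense_exists by blast
  have "cball c r = (\<Inter>d\<in>D. {x. x \<bullet> d \<le> c \<bullet> d + r * norm d})" (is "_ = ?I")
  proof (intro equalityI subsetI INT_I CollectI)
    fix x d :: 'h assume "x \<in> cball c r"
    then have "norm (x - c) * norm d \<le> r * norm d"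
      by (intro mult_right_mono) (auto simp: dist_norm norm_minus_commute)
    then show "x \<bullet> d \<le> c \<bullet> d + r * norm d"
      using norm_cauchy_schwarz[of "x - c" d] by (simp add: inner_diff_left)
  next
    fix x assume x: "x \<in> ?I"
    have closed: "closed {d. (x - c) \<bullet> d \<le> r * norm d}"
      by (intro closed_Collect_le continuous_intros)
    have "UNIV \<subseteq> {d. (x - c) \<bullet> d \<le> r * norm d}"
    proof (rule ccontr)
      assume "\<not> ?thesis"
      then obtain d where "d \<in> D" "d \<in> - {d. (x - c) \<bullet> d \<le> r * norm d}"
        using D(2)[of "- {d. (x - c) \<bullet> d \<le> r * norm d}"] closed by (auto simp: closed_def)
      then show False using x by (auto simp: inner_diff_left)
    qed
    then have "(x - c) \<bullet> (x - c) \<le> r * norm (x - c)" by blast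
    then have "norm (x - c) * norm (x - c) \<le> r * norm (x - c)"
      by (simp add: dot_square_norm power2_eq_square)
    then have "norm (x - c) \<le> r"
      using assms by (cases "norm (x - c) = 0") auto
    then show "x \<in> cball c r" by (simp add: dist_norm norm_minus_commute)
  qed
  moreover have "(\<Inter>d\<in>D. {x. x \<bullet> d \<le> c \<bullet> d + r * norm d}) \<in> sigma_sets UNIV cylinders"
  proof -
    interpret sigma_algebra UNIV "sigma_sets UNIV cylinders :: 'h set set"
      by (rule sigma_algebra_sigma_sets) simp
    have "{x. x \<bullet> d \<le> c \<bullet> d + r * norm d} \<in> sigma_sets UNIV cylinders" for d
      using cylinders.Int[OF cylinders.UNIV, of d "c \<bullet> d + r * norm d"] by auto
    moreover have "D \<noteq> {}" using D(2)[of UNIV] by auto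
    ultimately show ?thesis using D(1) by (intro countable_INT') auto
  qed
  ultimately show ?thesis by simp
qed

text \<open>
  Separability enters a second time here: an open set is a countable union of closed balls with
  rational radii and centres in a dense sequence.
\<close>

lemma sets_borel_eq_cylinders:
  "sets (borel :: 'h::{real_inner, second_countable_topology} measure) = sigma_sets UNIV cylinders"
proof
  interpret sigma_algebra UNIV "sigma_sets UNIV cylinders :: 'h set set"
    by (rule sigma_algebra_sigma_sets) simp
  obtain D :: "'h set" where D: "countable D" "\<And>X. open X \<Longrightarrow> X \<noteq> {} \<Longrightarrow> \<exists>d\<in>D. d \<in> X"
    using countable_dense_exists by blast
  have "U \<in> sigma_sets UNIV cylinders" if "open U" for U :: "'h set"
  proof -
    define I where "I = {(d, q). d \<in> D \<and> q \<in> \<rat> \<and> 0 \<le> q \<and> cball d q \<subseteq> U}"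
    have "U \<subseteq> (\<Union>(d, q)\<in>I. cball d q)"
    proof
      fix x assume "x \<in> U"
      then obtain e where e: "e > 0" "ball x e \<subseteq> U" using \<open>open U\<close> openE by blast
      obtain q where q: "q \<in> \<rat>" "0 < q" "q < e / 2"
        using Rats_dense_in_real[of 0 "e / 2"] e by auto
      obtain d where d: "d \<in> D" "dist x d < q"
        using D(2)[of "ball x q"] q by auto
      have "cball d q \<subseteq> ball x e"
      proof
        fix y assume "y \<in> cball d q"
        then show "y \<in> ball x e" using d q dist_triangle[of x y d] by auto
      qed
      then show "x \<in> (\<Union>(d, q)\<in>I. cball d q)"
        using d q e by (intro UN_I[of "(d, q)"]) (auto simp: I_def dist_commute)
    qed
    then have "U = (\<Union>(d, q)\<in>I. cball d q)" by (auto simp: I_def)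
    moreover have "countable I"
      by (rule countable_subset[of _ "D \<times> \<rat>"]) (auto simp: I_def D countable_rat)
    moreover have "(\<lambda>(d, q). cball d q) ` I \<subseteq> sigma_sets UNIV cylinders"
      by (auto simp: I_def intro!: cball_in_sigma_cylinders)
    ultimately show ?thesis
      using countable_UN'[of I "\<lambda>(d, q). cball d q"] by simp
  qed
  then show "sets borel \<subseteq> (sigma_sets UNIV cylinders :: 'h set set)"
    unfolding borel_def by (subst sets_measure_of) (auto intro!: sigma_sets_mono)
  show "(sigma_sets UNIV cylinders :: 'h set set) \<subseteq> sets borel"
    using cylinders_borel sets.sigma_sets_subset[of cylinders borel] by auto
qed

text \<open>
  Induction over the cylinders shows that the restrictions of \<open>M\<close> and \<open>N\<close> to any cylinder have the
  same cosine integrals. The cosine of the zero phase is the constant \<open>1\<close>, so the measures agree on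
  the cylinders, an intersection-stable generator of the Borel sets.
\<close>

lemma char_functional_unique:
  fixes M N :: "'h::{real_inner, second_countable_topology} measure"
  assumes fin: "finite_measure M" "finite_measure N"
    and sets: "sets M = sets borel" "sets N = sets borel"
    and char: "char_functional M = char_functional N"
  shows "M = N"
proof (rule measure_eqI_generator_eq[OF Int_stable_cylinders])
  have dens: "finite_measure (density L (indicator A)) \<and> sets (density L (indicator A)) = sets borel \<and>
      measure (density L (indicator A)) (space L) = measure L A"
    if "finite_measure L" "sets L = sets borel" "A \<in> cylinders" for L and A :: "'h set"
  proof -
    interpret L: finite_measure L by fact
    have "emeasure (density L (indicator A)) (space L) = emeasure L A"
      using that cylinders_borel[of A] by (subst emeasure_density) (auto simp: sets.sets_into_space)
    then show ?thesis using that by (auto intro!: finite_measureI simp: measure_def)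
  qed
  have cyl: "cos_integrals_agree (density M (indicator A)) (density N (indicator A))"
    if "A \<in> cylinders" for A
    using that
  proof induction
    case UNIV
    then show ?case using char by (simp add: cos_integrals_agree_iff_char_functional fin sets indicator_def density_1)
  next
    case (Int A \<xi> c)
    let ?H = "{x. x \<bullet> \<xi> \<le> c}"
    have "density L (indicator (A \<inter> ?H)) = density (density L (indicator A)) (indicator ?H)"
      if "sets L = sets borel" for L
    proof -
      have "indicator (A \<inter> ?H) = (\<lambda>x. indicator A x * indicator ?H x :: ennreal)"
        by (simp add: fun_eq_iff indicator_inter_arith)
      then show ?thesis
        using that Int.hyps cylinders_borel[of A] by (subst density_density_eq) auto
    qed
    then show ?case
      using Int dens fin sets by (simp add: cos_integrals_agree_halfspace)
  qed
  fix A :: "'h set" assume A: "A \<in> cylinders"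
  interpret M: finite_measure M by fact
  interpret N: finite_measure N by fact
  have "(\<integral>x. cos (x \<bullet> 0 + 0) \<partial>density M (indicator A)) = (\<integral>x. cos (x \<bullet> 0 + 0) \<partial>density N (indicator A))"
    using cyl[OF A] unfolding cos_integrals_agree_def by blast
  then have "measure M A = measure N A"
    using dens[OF fin(1) sets(1) A] dens[OF fin(2) sets(2) A] by simp
  then show "emeasure M A = emeasure N A"
    by (simp add: M.emeasure_eq_measure N.emeasure_eq_measure)
qed (use finite_measure.emeasure_finite[OF fin(1)] in
    \<open>auto simp: sets sets_borel_eq_cylinders cylinders.UNIV\<close>)

section \<open>The characterisation of skew convolution semigroups\<close>

lemma char_functional_conv:
  fixes M N :: "'h::{real_inner, second_countable_topology} measure"
  assumes M: "M \<in> space (prob_algebra borel)" and N: "N \<in> space (prob_algebra borel)"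
  shows "char_functional (M \<^bold>* N) \<xi> = char_functional M \<xi> * char_functional N \<xi>"
proof -
  have [measurable_cong]: "sets M = sets borel" "sets N = sets borel"
    using M N by (auto simp: space_prob_algebra)
  interpret M: prob_space M using M by (simp add: space_prob_algebra)
  interpret N: prob_space N using N by (simp add: space_prob_algebra)
  interpret MN: pair_prob_space M N ..
  have "integrable (M \<Otimes>\<^sub>M N) (\<lambda>(x, y). iexp ((x + y) \<bullet> \<xi>))"
    by (rule MN.P.integrable_const_bound[where B = 1]) auto
  from MN.integral_fst'[OF this]
  have "char_functional (M \<^bold>* N) \<xi> = (CLINT x|M. CLINT y|N. iexp ((x + y) \<bullet> \<xi>))"
    by (simp add: char_functional_def conv_measure_def integral_distr split_beta')
  also have "\<dots> = (CLINT x|M. CLINT y|N. iexp (x \<bullet> \<xi>) * iexp (y \<bullet> \<xi>))"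
    by (simp add: inner_add_left distrib_left exp_add)
  finally show ?thesis by (simp add: char_functional_def)
qed

lemma skew_convolution_iff_char:
  fixes u :: "real \<Rightarrow> real \<Rightarrow> 'h::{real_inner, second_countable_topology} \<Rightarrow> 'h measure"
  assumes u: "markov_transition u" and \<mu>: "prob_family \<mu>"
  shows "skew_convolution u \<mu> \<longleftrightarrow> skew_convolution_char u \<mu>"
proof -
  have add: "(\<lambda>(x, y). x + y) \<in> borel \<Otimes>\<^sub>M borel \<rightarrow>\<^sub>M (borel :: 'h measure)"
    by measurable
  have \<mu>_prob: "\<mu> t s \<in> space (prob_algebra borel)" if "s \<le> t" for s t
    using \<mu> that by (auto simp: prob_family_def space_prob_algebra)
  have step: "\<mu> t s = \<mu> t r \<^bold>* (\<mu> r s \<bind> u r t) \<longleftrightarrow>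
      (\<forall>\<xi>. char_functional (\<mu> t s) \<xi> =
        char_functional (\<mu> t r) \<xi> * char_functional (\<mu> r s \<bind> u r t) \<xi>)"
    if st: "s \<le> r" "r \<le> t" for s r t
  proof -
    have \<mu>u: "\<mu> r s \<bind> u r t \<in> space (prob_algebra borel)"
      using st u by (intro bind_in_prob_algebra[where L = borel] \<mu>_prob) (auto simp: markov_transition_def)
    have "\<mu> t r \<^bold>* (\<mu> r s \<bind> u r t) \<in> space (prob_algebra borel)" "\<mu> t s \<in> space (prob_algebra borel)"
      using st by (simp_all add: conv_in_prob_algebra[OF add] \<mu>_prob \<mu>u)
    then have "\<mu> t s = \<mu> t r \<^bold>* (\<mu> r s \<bind> u r t)"
      if "char_functional (\<mu> t s) = char_functional (\<mu> t r \<^bold>* (\<mu> r s \<bind> u r t))"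
      using that by (intro char_functional_unique) (simp_all add: space_prob_algebra prob_space_def)
    then have "\<mu> t s = \<mu> t r \<^bold>* (\<mu> r s \<bind> u r t) \<longleftrightarrow>
        char_functional (\<mu> t s) = char_functional (\<mu> t r \<^bold>* (\<mu> r s \<bind> u r t))"
      by (intro iffI) (erule arg_cong)
    then show ?thesis
      unfolding fun_eq_iff[of "char_functional (\<mu> t s)"] char_functional_conv[OF \<mu>_prob[OF st(2)] \<mu>u] .
  qed
  have "skew_convolution u \<mu> \<longleftrightarrow> (\<forall>s r t. s \<le> r \<longrightarrow> r \<le> t \<longrightarrow>
      (\<forall>\<xi>. char_functional (\<mu> t s) \<xi> =
        char_functional (\<mu> t r) \<xi> * char_functional (\<mu> r s \<bind> u r t) \<xi>))"
    unfolding skew_convolution_def by (intro all_cong1 imp_cong refl step)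
  also have "\<dots> \<longleftrightarrow> skew_convolution_char u \<mu>"
    unfolding skew_convolution_char_def by blast
  finally show ?thesis .
qed

theorem proposition2p3:
  fixes u :: "real \<Rightarrow> real \<Rightarrow> 'a::{topological_space, comm_monoid_add} \<Rightarrow> 'a measure"
    and \<mu> :: "real \<Rightarrow> real \<Rightarrow> 'a measure"
    and v :: "real \<Rightarrow> real \<Rightarrow> 'h::{real_inner, polish_space} \<Rightarrow> 'h measure"
    and \<nu> :: "real \<Rightarrow> real \<Rightarrow> 'h measure"
  shows
    "((\<lambda>(x, y). x + y) \<in> borel \<Otimes>\<^sub>M borel \<rightarrow>\<^sub>M (borel :: 'a measure) \<longrightarrow>
      markov_transition u \<longrightarrow> additive_transition u \<longrightarrow> prob_family \<mu> \<longrightarrow>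
        (evolution_family (mehler_kernel u \<mu>) \<longleftrightarrow> skew_convolution u \<mu>))
     \<and>
     (markov_transition v \<longrightarrow> additive_transition v \<longrightarrow> prob_family \<nu> \<longrightarrow>
        (evolution_family (mehler_kernel v \<nu>) \<longleftrightarrow> skew_convolution v \<nu>) \<and>
        (evolution_family (mehler_kernel v \<nu>) \<longleftrightarrow> skew_convolution_char v \<nu>))"
proof (intro conjI impI)
  assume "(\<lambda>(x, y). x + y) \<in> borel \<Otimes>\<^sub>M borel \<rightarrow>\<^sub>M (borel :: 'a measure)"
    "markov_transition u" "additive_transition u" "prob_family \<mu>"
  then show "evolution_family (mehler_kernel u \<mu>) \<longleftrightarrow> skew_convolution u \<mu>"
    by (rule mehler_kernel_evolution_iff)
next
  assume v: "markov_transition v" "additive_transition v" and \<nu>: "prob_family \<nu>"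
  have "(\<lambda>(x, y). x + y) \<in> borel \<Otimes>\<^sub>M borel \<rightarrow>\<^sub>M (borel :: 'h measure)"
    by measurable
  from mehler_kernel_evolution_iff[OF this v \<nu>]
  show "evolution_family (mehler_kernel v \<nu>) \<longleftrightarrow> skew_convolution v \<nu>" .
  also have "\<dots> \<longleftrightarrow> skew_convolution_char v \<nu>"
    by (rule skew_convolution_iff_char[OF v(1) \<nu>])
  finally show "evolution_family (mehler_kernel v \<nu>) \<longleftrightarrow> skew_convolution_char v \<nu>" .
qed

end
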